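(* Suppose that $\sigma_1,\sigma_2:\mathbb{R}^N\to(0,\infty]$ are two screening functions such that $$0<\inf_{\mathbb{R}^N}\sigma_i\le\sup_{\mathbb{R}^N}\sigma_i<\infty\quad\text{for }i=1,2.$$ Then for $0<s<1$ and $1\le p<\infty$ there exist constants $c_i=c_i(s,p,N,\sigma_1,\sigma_2)>0$ for $i=0,1$ such that $$c_0|f|_{\tilde{W}^{s,p}_{(\sigma_2)}(\mathbb{R}^N)}\le|f|_{\tilde{W}^{s,p}_{(\sigma_1)}(\mathbb{R}^N)}\le c_1|f|_{\tilde{W}^{s,p}_{(\sigma_2)}(\mathbb{R}^N)}$$ for all $f\in L^1_{\mathrm{loc}}(\mathbb{R}^N)$, and consequently we have the algebraic and topological equality $\tilde{W}^{s,p}_{(\sigma_1)}(\mathbb{R}^N)=\tilde{W}^{s,p}_{(\sigma_2)}(\mathbb{R}^N)$.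
   Context: A screening function on $\mathbb{R}^N$ is a lower semicontinuous function $\sigma:\mathbb{R}^N\to(0,\infty]$. For $f\in L^1_{\mathrm{loc}}(\mathbb{R}^N)$, $$|f|_{\tilde{W}^{s,p}_{(\sigma)}(\mathbb{R}^N)}:=\left(\int_{\mathbb{R}^N}\int_{B(0,\sigma(x))}\frac{|f(x+h)-f(x)|^p}{|h|^{sp+N}}\,dh\,dx\right)^{1/p}\in[0,\infty],$$ with $B(0,r)$ the open ball (and $B(0,\infty)=\mathbb{R}^N$). $\tilde{W}^{s,p}_{(\sigma)}(\mathbb{R}^N)$ is the space of $f\in L^1_{\mathrm{loc}}(\mathbb{R}^N)$ for which this seminorm is finite, endowed with the topology of the seminorm. *)

theory Defs
  imports "HOL-Analysis.Analysis"
begin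

definition lower_semicontinuous :: "('a::topological_space \<Rightarrow> ereal) \<Rightarrow> bool" where
  "lower_semicontinuous \<sigma> \<longleftrightarrow> (\<forall>a. open {x. a < \<sigma> x})"

definition screening_function :: "(real ^ 'n \<Rightarrow> ereal) \<Rightarrow> bool" where
  "screening_function \<sigma> \<longleftrightarrow> lower_semicontinuous \<sigma> \<and> (\<forall>x. 0 < \<sigma> x)"

text \<open>Functions are used as representatives: functions that agree almost everywhere are not
  identified, here and in the function spaces below.\<close>

definition L1_loc :: "(real ^ 'n \<Rightarrow> real) set" where
  "L1_loc = {f. \<forall>K. compact K \<longrightarrow> f absolutely_integrable_on K}"

definition ennpowr :: "ennreal \<Rightarrow> real \<Rightarrow> ennreal" where
  "ennpowr t a = (if t = \<infinity> then \<infinity> else ennreal (enn2real t powr a))"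

definition screened_ball :: "ereal \<Rightarrow> (real ^ 'n) set" where
  "screened_ball r = {h. ereal (norm h) < r}"

text \<open>At \<open>h = 0\<close> the integrand below has the value \<open>0\<close>, by the convention for division by zero;
  this concerns a null set only.\<close>

definition screened_seminorm ::
  "real \<Rightarrow> real \<Rightarrow> (real ^ 'n \<Rightarrow> ereal) \<Rightarrow> (real ^ 'n \<Rightarrow> real) \<Rightarrow> ennreal" where
  "screened_seminorm s p \<sigma> f =
     ennpowr
       (\<integral>\<^sup>+x. (\<integral>\<^sup>+h\<in>screened_ball (\<sigma> x).
           ennreal (\<bar>f (x + h) - f x\<bar> powr p / norm h powr (s * p + real CARD('n))) \<partial>lebesgue) \<partial>lebesgue)
       (1 / p)"

definition screened_space ::
  "real \<Rightarrow> real \<Rightarrow> (real ^ 'n \<Rightarrow> ereal) \<Rightarrow> (real ^ 'n \<Rightarrow> real) set" where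
  "screened_space s p \<sigma> = {f \<in> L1_loc. screened_seminorm s p \<sigma> f < \<infinity>}"

definition screened_topology ::
  "real \<Rightarrow> real \<Rightarrow> (real ^ 'n \<Rightarrow> ereal) \<Rightarrow> (real ^ 'n \<Rightarrow> real) topology" where
  "screened_topology s p \<sigma> = topology (\<lambda>U. U \<subseteq> screened_space s p \<sigma> \<and>
     (\<forall>f\<in>U. \<exists>r>0. \<forall>g\<in>screened_space s p \<sigma>.
        screened_seminorm s p \<sigma> (\<lambda>x. g x - f x) < ennreal r \<longrightarrow> g \<in> U))"

lemma openin_screened_topology:
  "openin (screened_topology s p \<sigma>) U \<longleftrightarrow> U \<subseteq> screened_space s p \<sigma> \<and>
     (\<forall>f\<in>U. \<exists>r>0. \<forall>g\<in>screened_space s p \<sigma>.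
        screened_seminorm s p \<sigma> (\<lambda>x. g x - f x) < ennreal r \<longrightarrow> g \<in> U)"
proof -
  let ?W = "screened_space s p \<sigma>"
  let ?near = "\<lambda>f r g. screened_seminorm s p \<sigma> (\<lambda>x. g x - f x) < ennreal r"
  let ?P = "\<lambda>U. U \<subseteq> ?W \<and> (\<forall>f\<in>U. \<exists>r>0. \<forall>g\<in>?W. ?near f r g \<longrightarrow> g \<in> U)"
  have "istopology ?P"
    unfolding istopology_def
  proof (intro conjI allI impI)
    fix S T assume S: "?P S" and T: "?P T"
    show "S \<inter> T \<subseteq> ?W" using S by blast
    show "\<forall>f\<in>S \<inter> T. \<exists>r>0. \<forall>g\<in>?W. ?near f r g \<longrightarrow> g \<in> S \<inter> T"
    proof
      fix f assume "f \<in> S \<inter> T"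
      then obtain r q where r: "r > 0" "\<forall>g\<in>?W. ?near f r g \<longrightarrow> g \<in> S"
        and q: "q > 0" "\<forall>g\<in>?W. ?near f q g \<longrightarrow> g \<in> T"
        using S T by blast
      have "?near f r g \<and> ?near f q g" if "?near f (min r q) g" for g
        using that by (meson ennreal_leI min.cobounded1 min.cobounded2 order_less_le_trans)
      then show "\<exists>r>0. \<forall>g\<in>?W. ?near f r g \<longrightarrow> g \<in> S \<inter> T"
        using r q by (intro exI[of _ "min r q"]) auto
    qed
  next
    fix \<K> assume K: "\<forall>K\<in>\<K>. ?P K"
    show "\<Union>\<K> \<subseteq> ?W" using K by blast
    show "\<forall>f\<in>\<Union>\<K>. \<exists>r>0. \<forall>g\<in>?W. ?near f r g \<longrightarrow> g \<in> \<Union>\<K>"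
      using K by (meson UnionE UnionI)
  qed
  then show ?thesis
    by (simp add: screened_topology_def)
qed

lemma topspace_screened_topology: "topspace (screened_topology s p \<sigma>) = screened_space s p \<sigma>"
proof
  show "topspace (screened_topology s p \<sigma>) \<subseteq> screened_space s p \<sigma>"
    using openin_screened_topology openin_topspace by blast
  have "openin (screened_topology s p \<sigma>) (screened_space s p \<sigma>)"
    unfolding openin_screened_topology by (auto intro: exI[of _ 1])
  then show "screened_space s p \<sigma> \<subseteq> topspace (screened_topology s p \<sigma>)"
    by (rule openin_subset)
qed

end

theory Submission
  imports Defs
begin

text \<open>Bounded screening functions are squeezed between two constants, so it suffices to compare the
  energies of two constant radii. Substituting \<open>h = 2k\<close> and splitting \<open>f (x + 2k) - f x\<close> at the
  midpoint \<open>x + k\<close> bounds the energy of radius \<open>2r\<close> by a multiple of that of radius \<open>r\<close>, after Tonelli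
  and a translation in \<open>x\<close>; iteration reaches every larger radius. Tonelli needs joint measurability,
  hence the passage from \<open>f\<close> to an almost everywhere equal Borel function.\<close>

section \<open>Powers on the extended half-line and energies of constant radius\<close>

lemma ennpowr_mono:
  assumes "t \<le> u" "0 \<le> a"
  shows "ennpowr t a \<le> ennpowr u a"
proof (cases "u = \<infinity>")
  case False
  then have "enn2real t \<le> enn2real u"
    using assms by (simp add: enn2real_mono top.not_eq_extremum)
  then show ?thesis
    using False assms by (auto simp: ennpowr_def top_unique intro!: ennreal_leI powr_mono2)
qed (simp add: ennpowr_def)

text \<open>Since \<open>c\<close> is positive and finite, \<open>ennreal c * t\<close> is infinite
  exactly when \<open>t\<close> is, so both sides fall into the same branch of
  \<open>ennpowr\<close>.\<close>

lemma ennpowr_cmult: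
  assumes "0 < c"
  shows "ennpowr (ennreal c * t) a = ennreal (c powr a) * ennpowr t a"
  using assms
  by (auto simp: ennpowr_def ennreal_mult_eq_top_iff ennreal_mult_top enn2real_mult powr_mult
      ennreal_mult' ennreal_top_eq_mult_iff)

text \<open>For \<open>q = s * p + N\<close> this is the p-th power of the seminorm whose screening
  function is the constant \<open>r\<close>. Integrating over \<open>lborel\<close> gives direct
  access to Tonelli and to changes of variables.\<close>

definition screened_energy :: "real \<Rightarrow> real \<Rightarrow> real \<Rightarrow> ('a::euclidean_space \<Rightarrow> real) \<Rightarrow> ennreal" where
  "screened_energy p q r f = (\<integral>\<^sup>+x. \<integral>\<^sup>+h. ennreal (\<bar>f (x + h) - f x\<bar> powr p / norm h powr q)
     * indicator (ball 0 r) h \<partial>lborel \<partial>lborel)"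

section \<open>Changes of variables and doubling of the radius\<close>

lemma nn_integral_lborel_translate:
  fixes F :: "'a::euclidean_space \<Rightarrow> ennreal"
  assumes "F \<in> borel_measurable borel"
  shows "(\<integral>\<^sup>+x. F (x + a) \<partial>lborel) = (\<integral>\<^sup>+x. F x \<partial>lborel)"
proof -
  have "(\<integral>\<^sup>+x. F x \<partial>lborel) = (\<integral>\<^sup>+x. F x \<partial>distr lborel borel ((+) a))"
    by (simp add: lborel_distr_plus)
  also have "\<dots> = (\<integral>\<^sup>+x. F (x + a) \<partial>lborel)"
    using assms by (subst nn_integral_distr) (auto simp: add.commute)
  finally show ?thesis by simp
qed

lemma nn_integral_lborel_scale:
  fixes F :: "'a::euclidean_space \<Rightarrow> ennreal"
  assumes F: "F \<in> borel_measurable borel" and "c \<noteq> 0"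
  shows "(\<integral>\<^sup>+x. F x \<partial>lborel) = ennreal (\<bar>c\<bar> ^ DIM('a)) * (\<integral>\<^sup>+x. F (c *\<^sub>R x) \<partial>lborel)"
proof -
  have "(\<integral>\<^sup>+x. F x \<partial>lborel)
      = (\<integral>\<^sup>+x. F x \<partial>density (distr lborel borel (\<lambda>x. 0 + c *\<^sub>R x)) (\<lambda>_. ennreal (\<bar>c\<bar> ^ DIM('a))))"
    using lborel_affine[OF \<open>c \<noteq> 0\<close>, of "0 :: 'a"] by simp
  also have "\<dots> = ennreal (\<bar>c\<bar> ^ DIM('a)) * (\<integral>\<^sup>+x. F (c *\<^sub>R x) \<partial>lborel)"
    using F by (simp add: nn_integral_density nn_integral_distr nn_integral_cmult)
  finally show ?thesis .
qed

text \<open>Bounding both summands by their maximum treats all exponents at once, with no case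
  distinction on convexity.\<close>

lemma powr_add_le:
  fixes a b p :: real
  assumes "0 \<le> a" "0 \<le> b" "0 \<le> p"
  shows "(a + b) powr p \<le> 2 powr p * (a powr p + b powr p)"
proof -
  have "(a + b) powr p \<le> (2 * max a b) powr p"
    using assms by (intro powr_mono2) auto
  also have "\<dots> = 2 powr p * max a b powr p"
    using assms by (simp add: powr_mult)
  also have "max a b powr p \<le> a powr p + b powr p"
    by (simp add: max_def)
  finally show ?thesis by simp
qed

text \<open>The three factors of the constant: \<open>2 ^ DIM('a)\<close> is the Jacobian of h = 2k,
  \<open>2 powr p\<close> comes from \<open>powr_add_le\<close> at the midpoint, and the last 2
  counts the two half-steps, each contributing one energy of radius \<open>r\<close>.\<close>

lemma screened_energy_double:
  fixes g :: "'a::euclidean_space \<Rightarrow> real"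
  assumes [measurable]: "g \<in> borel_measurable borel" and "0 \<le> p" "0 \<le> q"
  shows "screened_energy p q (2 * r) g
       \<le> ennreal (2 ^ DIM('a) * 2 powr p * 2) * screened_energy p q r g"
proof -
  let ?G = "\<lambda>x h. ennreal (\<bar>g (x + h) - g x\<bar> powr p / norm h powr q)"
  define F where "F x k = ?G x k * indicator (ball 0 r) k" for x k :: 'a
  have F_meas [measurable]: "case_prod F \<in> borel_measurable (borel \<Otimes>\<^sub>M borel)"
    unfolding F_def indicator_def mem_ball_0 by measurable
  have energy: "screened_energy p q r g = (\<integral>\<^sup>+x. \<integral>\<^sup>+k. F x k \<partial>lborel \<partial>lborel)"
    by (simp add: screened_energy_def F_def)
  \<comment> \<open>The half-step from x + k to x + 2k has its base point displaced by k. Once k is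
    the outer variable it is constant for the x-integral, which is translation invariant.\<close>
  have shifted: "(\<integral>\<^sup>+x. \<integral>\<^sup>+k. F (x + k) k \<partial>lborel \<partial>lborel) = (\<integral>\<^sup>+x. \<integral>\<^sup>+k. F x k \<partial>lborel \<partial>lborel)"
  proof -
    have "(\<integral>\<^sup>+x. \<integral>\<^sup>+k. F (x + k) k \<partial>lborel \<partial>lborel) = (\<integral>\<^sup>+k. \<integral>\<^sup>+x. F (x + k) k \<partial>lborel \<partial>lborel)"
      by (rule lborel_pair.Fubini'[symmetric]) measurable
    also have "\<dots> = (\<integral>\<^sup>+k. \<integral>\<^sup>+x. F x k \<partial>lborel \<partial>lborel)"
      by (intro nn_integral_cong nn_integral_lborel_translate) measurable
    also have "\<dots> = (\<integral>\<^sup>+x. \<integral>\<^sup>+k. F x k \<partial>lborel \<partial>lborel)"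
      by (rule lborel_pair.Fubini') measurable
    finally show ?thesis .
  qed
  have pointwise: "?G x (2 *\<^sub>R k) * indicator (ball 0 (2 * r)) (2 *\<^sub>R k)
      \<le> ennreal (2 powr p) * (F (x + k) k + F x k)" for x k
  \<comment> \<open>In the remaining case the left side is 0: outside the ball by the indicator, and
    at k = 0 because the increment of \<open>g\<close> vanishes and \<open>0 powr p\<close> is
    0.\<close>
  proof (cases "k \<in> ball 0 r \<and> k \<noteq> 0")
    case True
    let ?a = "\<bar>g (x + k + k) - g (x + k)\<bar>" and ?b = "\<bar>g (x + k) - g x\<bar>"
    have "\<bar>g (x + 2 *\<^sub>R k) - g x\<bar> powr p \<le> (?a + ?b) powr p"
      using assms by (intro powr_mono2) (auto simp: scaleR_2 add.assoc)
    also have "\<dots> \<le> 2 powr p * (?a powr p + ?b powr p)"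
      using assms by (intro powr_add_le) auto
    \<comment> \<open>As \<open>q\<close> \<ge> 0, the denominator may be shrunk from the norm of 2k
      to that of k; the gain of \<open>2 powr q\<close> is discarded.\<close>
    finally have "\<bar>g (x + 2 *\<^sub>R k) - g x\<bar> powr p / norm (2 *\<^sub>R k) powr q
        \<le> 2 powr p * (?a powr p + ?b powr p) / norm k powr q"
      using True assms by (intro frac_le powr_mono2) auto
    also have "\<dots> = 2 powr p * (?a powr p / norm k powr q + ?b powr p / norm k powr q)"
      by (metis add_divide_distrib times_divide_eq_right)
    finally have "?G x (2 *\<^sub>R k) \<le> ennreal (2 powr p) * (?G (x + k) k + ?G x k)"
      by (subst ennreal_plus[symmetric], simp, simp, subst ennreal_mult'[symmetric], simp,
          rule ennreal_leI)
    then show ?thesis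
      using True by (simp add: F_def)
  qed (auto simp: indicator_def)
  have "screened_energy p q (2 * r) g
      = (\<integral>\<^sup>+x. ennreal (2 ^ DIM('a)) *
          (\<integral>\<^sup>+k. ?G x (2 *\<^sub>R k) * indicator (ball 0 (2 * r)) (2 *\<^sub>R k) \<partial>lborel) \<partial>lborel)"
    unfolding screened_energy_def
  proof (rule nn_integral_cong)
    fix x
    have "(\<lambda>h. ?G x h * indicator (ball 0 (2 * r)) h) \<in> borel_measurable borel"
      unfolding indicator_def mem_ball_0 by measurable
    from nn_integral_lborel_scale[OF this, of 2]
    show "(\<integral>\<^sup>+h. ?G x h * indicator (ball 0 (2 * r)) h \<partial>lborel) = ennreal (2 ^ DIM('a)) *
        (\<integral>\<^sup>+k. ?G x (2 *\<^sub>R k) * indicator (ball 0 (2 * r)) (2 *\<^sub>R k) \<partial>lborel)"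
      by simp
  qed
  also have "\<dots> \<le> (\<integral>\<^sup>+x. ennreal (2 ^ DIM('a)) *
          (\<integral>\<^sup>+k. ennreal (2 powr p) * (F (x + k) k + F x k) \<partial>lborel) \<partial>lborel)"
    by (intro nn_integral_mono mult_left_mono pointwise) auto
  also have "\<dots> = ennreal (2 ^ DIM('a)) * (ennreal (2 powr p) *
      ((\<integral>\<^sup>+x. \<integral>\<^sup>+k. F (x + k) k \<partial>lborel \<partial>lborel) + (\<integral>\<^sup>+x. \<integral>\<^sup>+k. F x k \<partial>lborel \<partial>lborel)))"
    by (simp add: nn_integral_cmult nn_integral_add)
  also have "\<dots> = ennreal (2 ^ DIM('a) * 2 powr p * 2) * screened_energy p q r g"
    by (simp add: shifted energy ennreal_mult' mult.assoc flip: mult_2)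
  finally show ?thesis .
qed

lemma screened_energy_mono: "r \<le> r' \<Longrightarrow> screened_energy p q r f \<le> screened_energy p q r' f"
  unfolding screened_energy_def
  by (intro nn_integral_mono mult_left_mono) (auto simp: indicator_def)

lemma screened_energy_pow2:
  fixes g :: "'a::euclidean_space \<Rightarrow> real"
  assumes "g \<in> borel_measurable borel" and "0 \<le> p" "0 \<le> q"
  shows "screened_energy p q (2 ^ n * r) g
       \<le> ennreal ((2 ^ DIM('a) * 2 powr p * 2) ^ n) * screened_energy p q r g"
proof (induction n)
  case (Suc n)
  let ?C = "2 ^ DIM('a) * 2 powr p * 2 :: real"
  have "screened_energy p q (2 ^ Suc n * r) g \<le> ennreal ?C * screened_energy p q (2 ^ n * r) g"
    using screened_energy_double[OF assms, of "2 ^ n * r"] by (simp add: mult.assoc)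
  also have "\<dots> \<le> ennreal ?C * (ennreal (?C ^ n) * screened_energy p q r g)"
    by (intro mult_left_mono Suc.IH) auto
  also have "\<dots> = ennreal (?C ^ Suc n) * screened_energy p q r g"
    by (simp add: ennreal_mult' mult.assoc)
  finally show ?case .
qed simp

section \<open>Null sets and measurable representatives\<close>

lemma AE_lborel_translate:
  fixes a :: "'a::euclidean_space"
  assumes "AE x in lborel. P x"
  shows "AE x in lborel. P (a + x)"
proof -
  \<comment> \<open>The exceptional set of \<open>P\<close> may fail to be Borel, so a Borel null
    set containing it is translated instead.\<close>
  obtain N where N: "{x \<in> space lborel. \<not> P x} \<subseteq> N" "emeasure lborel N = 0" "N \<in> sets lborel"
    using assms by (rule AE_E)
  have "AE x in lborel. x \<notin> N"
    using N by (intro AE_not_in) auto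
  then have "AE x in distr lborel borel ((+) a). x \<notin> N"
    by (simp only: lborel_distr_plus)
  then have "AE x in lborel. a + x \<notin> N"
    using N(3) by (subst (asm) AE_distr_iff) auto
  then show ?thesis
    by eventually_elim (use N(1) in auto)
qed

text \<open>The integrand evaluates the function at x and at x + h. Outside a null set of x the
  first values agree; for each such x the second ones agree for almost every h, by translating the
  exceptional set.\<close>

lemma screened_energy_cong_AE:
  assumes "AE x in lborel. f x = g x"
  shows "screened_energy p q r f = screened_energy p q r g"
  unfolding screened_energy_def
proof (rule nn_integral_cong_AE, use assms in eventually_elim)
  case (elim x)
  show ?case
    by (rule nn_integral_cong_AE, use AE_lborel_translate[OF assms, of x] in eventually_elim)
      (simp add: elim)
qed

text \<open>The truncations of \<open>f\<close> to closed balls are integrable by compactness, and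
  at each point they eventually equal \<open>f\<close>.\<close>

lemma L1_loc_borel_measurable:
  assumes "f \<in> L1_loc"
  shows "f \<in> borel_measurable lebesgue"
proof (rule borel_measurable_LIMSEQ_real)
  show "(\<lambda>x. indicat_real (cball 0 (real n)) x *\<^sub>R f x) \<in> borel_measurable lebesgue" for n
    using assms by (auto simp: L1_loc_def set_integrable_def intro!: borel_measurable_integrable)
  show "(\<lambda>n. indicat_real (cball 0 (real n)) x *\<^sub>R f x) \<longlonglongrightarrow> f x" for x
  proof (rule tendsto_eventually)
    obtain m :: nat where "norm x \<le> real m"
      using real_arch_simple by blast
    then show "\<forall>\<^sub>F n in sequentially. indicat_real (cball 0 (real n)) x *\<^sub>R f x = f x"
      by (auto simp: eventually_sequentially indicator_def intro!: exI[of _ m])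
  qed
qed

lemma L1_loc_diff:
  assumes "f \<in> L1_loc" "g \<in> L1_loc"
  shows "(\<lambda>x. g x - f x) \<in> L1_loc"
  using assms by (auto simp: L1_loc_def intro!: set_integral_diff)

section \<open>Comparison of radii and of seminorms\<close>

lemma screened_energy_compare:
  fixes m M p q :: real
  assumes "0 < m" "0 \<le> p" "0 \<le> q"
  obtains C :: real where "0 < C"
    "\<And>f :: real ^ 'n \<Rightarrow> real. f \<in> L1_loc \<Longrightarrow>
       screened_energy p q M f \<le> ennreal C * screened_energy p q m f"
proof -
  \<comment> \<open>The number of doublings depends only on the two radii, so the resulting constant
    is uniform in \<open>f\<close>.\<close>
  obtain n where "M / m < 2 ^ n"
    using real_arch_pow[of 2 "M / m"] by auto
  then have n: "M \<le> 2 ^ n * m"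
    using \<open>0 < m\<close> by (simp add: field_simps)
  let ?C = "(2 ^ DIM(real ^ 'n) * 2 powr p * 2) ^ n :: real"
  have "screened_energy p q M f \<le> ennreal ?C * screened_energy p q m f"
    if f: "f \<in> L1_loc" for f :: "real ^ 'n \<Rightarrow> real"
  proof -
    \<comment> \<open>The doubling bound is stated for Borel functions, while \<open>f\<close> is
      known to be Lebesgue measurable; passing to \<open>g\<close> leaves the energies
      unchanged.\<close>
    obtain g where g: "g \<in> borel_measurable lborel" "AE x in lborel. f x = g x"
      using completion_ex_borel_measurable_real[OF L1_loc_borel_measurable[OF f]] by auto
    show ?thesis
      using order_trans[OF screened_energy_mono[OF n] screened_energy_pow2[of g p q n m]] g assms
      by (simp add: screened_energy_cong_AE[OF g(2)])
  qed
  then show thesis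
    by (intro that[of ?C]) auto
qed

text \<open>Only the inner domain grows, as the ball of radius \<open>\<sigma> x\<close> lies in
  that of radius \<open>M\<close>. Lebesgue measure is the completion of \<open>lborel\<close> and
  yields the same nonnegative integrals.\<close>

lemma screened_seminorm_le:
  fixes f :: "real ^ 'n \<Rightarrow> real"
  assumes "\<And>x. \<sigma> x \<le> ereal M" "0 \<le> p"
  shows "screened_seminorm s p \<sigma> f
    \<le> ennpowr (screened_energy p (s * p + real CARD('n)) M f) (1 / p)"
  unfolding screened_seminorm_def screened_energy_def nn_integral_completion
  using assms
  by (intro ennpowr_mono nn_integral_mono mult_left_mono)
    (auto simp: indicator_def screened_ball_def simp flip: less_ereal.simps(1) intro: less_le_trans)

lemma screened_seminorm_ge:
  fixes f :: "real ^ 'n \<Rightarrow> real"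
  assumes "\<And>x. ereal m \<le> \<sigma> x" "0 \<le> p"
  shows "ennpowr (screened_energy p (s * p + real CARD('n)) m f) (1 / p)
    \<le> screened_seminorm s p \<sigma> f"
  unfolding screened_seminorm_def screened_energy_def nn_integral_completion
  using assms
  by (intro ennpowr_mono nn_integral_mono mult_left_mono)
    (auto simp: indicator_def screened_ball_def simp flip: less_ereal.simps(1) intro: less_le_trans)

text \<open>The upper bound of \<open>\<sigma>\<close> and the lower bound of \<open>\<tau>\<close>
  yield two constant radii to compare. Being one-sided, the estimate can be applied a second time
  with the roles exchanged.\<close>

lemma screened_seminorm_compare:
  fixes \<sigma> \<tau> :: "real ^ 'n \<Rightarrow> ereal"
  assumes "(SUP x. \<sigma> x) < \<infinity>" "0 < (INF x. \<tau> x)" "0 \<le> s" "0 \<le> p"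
  obtains c :: real where "0 < c"
    "\<And>f. f \<in> L1_loc \<Longrightarrow> screened_seminorm s p \<sigma> f \<le> ennreal c * screened_seminorm s p \<tau> f"
proof -
  obtain M :: real where "(SUP x. \<sigma> x) < ereal M"
    using assms(1) ereal_dense2 by blast
  then have M: "\<sigma> x \<le> ereal M" for x
    by (meson SUP_upper UNIV_I less_imp_le order_trans)
  \<comment> \<open>A number strictly below the infimum is real and positive, hence a legitimate
    constant radius.\<close>
  obtain m :: real where "0 < ereal m" "ereal m < (INF x. \<tau> x)"
    using assms(2) ereal_dense2 by blast
  then have m: "0 < m" "ereal m \<le> \<tau> x" for x
    by (auto intro: INF_lower order_trans less_imp_le)
  define q where "q = s * p + real CARD('n)"
  have "0 \<le> q"
    using assms by (simp add: q_def)
  then obtain C where C: "0 < C" "\<And>f :: real ^ 'n \<Rightarrow> real. f \<in> L1_loc \<Longrightarrow>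
       screened_energy p q M f \<le> ennreal C * screened_energy p q m f"
    using screened_energy_compare[of m p q M] m(1) assms(4) by blast
  have "screened_seminorm s p \<sigma> f \<le> ennreal (C powr (1 / p)) * screened_seminorm s p \<tau> f"
    if "f \<in> L1_loc" for f
  proof -
    have "screened_seminorm s p \<sigma> f \<le> ennpowr (screened_energy p q M f) (1 / p)"
      unfolding q_def using M assms by (intro screened_seminorm_le)
    also have "\<dots> \<le> ennpowr (ennreal C * screened_energy p q m f) (1 / p)"
      using C(2)[OF that] assms by (intro ennpowr_mono) auto
    also have "\<dots> = ennreal (C powr (1 / p)) * ennpowr (screened_energy p q m f) (1 / p)"
      using C(1) by (rule ennpowr_cmult)
    also have "\<dots> \<le> ennreal (C powr (1 / p)) * screened_seminorm s p \<tau> f"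
      unfolding q_def using m assms by (intro mult_left_mono screened_seminorm_ge) auto
    finally show ?thesis .
  qed
  then show thesis
    using C(1) by (intro that[of "C powr (1 / p)"]) auto
qed

section \<open>Equality of the spaces and of their topologies\<close>

lemma screened_space_mono:
  assumes "\<And>f. f \<in> L1_loc \<Longrightarrow> screened_seminorm s p \<sigma> f \<le> ennreal c * screened_seminorm s p \<tau> f"
  shows "screened_space s p \<tau> \<subseteq> screened_space s p \<sigma>"
  using assms by (force simp: screened_space_def ennreal_mult_less_top intro: le_less_trans)

text \<open>The seminorm bound makes the identity map continuous from the
  \<open>\<tau>\<close>-topology to the \<open>\<sigma>\<close>-topology: a
  \<open>\<tau>\<close>-ball of radius \<open>r / c\<close> lies in the \<open>\<sigma>\<close>-ball
  of radius \<open>r\<close> with the same centre.\<close>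

lemma openin_screened_topology_mono:
  assumes le: "\<And>f. f \<in> L1_loc \<Longrightarrow> screened_seminorm s p \<sigma> f \<le> ennreal c * screened_seminorm s p \<tau> f"
    and "0 < c" and eq: "screened_space s p \<sigma> = screened_space s p \<tau>"
    and U: "openin (screened_topology s p \<sigma>) U"
  shows "openin (screened_topology s p \<tau>) U"
  unfolding openin_screened_topology
proof (intro conjI ballI)
  show sub: "U \<subseteq> screened_space s p \<tau>"
    using U eq by (simp add: openin_screened_topology)
  fix f assume "f \<in> U"
  then obtain r where r: "r > 0" "\<And>g. g \<in> screened_space s p \<sigma> \<Longrightarrow>
      screened_seminorm s p \<sigma> (\<lambda>x. g x - f x) < ennreal r \<Longrightarrow> g \<in> U"
    using U unfolding openin_screened_topology by blast
  have "g \<in> U" if g: "g \<in> screened_space s p \<tau>"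
    and near: "screened_seminorm s p \<tau> (\<lambda>x. g x - f x) < ennreal (r / c)" for g
  proof (rule r(2))
    \<comment> \<open>The estimate \<open>le\<close> is available on \<open>L1_loc\<close> and is
      applied here to a difference.\<close>
    have "(\<lambda>x. g x - f x) \<in> L1_loc"
      using g \<open>f \<in> U\<close> sub by (intro L1_loc_diff) (auto simp: screened_space_def)
    then have "screened_seminorm s p \<sigma> (\<lambda>x. g x - f x)
        \<le> ennreal c * screened_seminorm s p \<tau> (\<lambda>x. g x - f x)"
      by (rule le)
    also have "\<dots> < ennreal c * ennreal (r / c)"
      using near \<open>0 < c\<close> by (intro ennreal_mult_strict_left_mono) auto
    also have "\<dots> = ennreal r"
      using \<open>0 < c\<close> by (simp flip: ennreal_mult')
    finally show "screened_seminorm s p \<sigma> (\<lambda>x. g x - f x) < ennreal r" .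
  qed (use g eq in simp)
  then show "\<exists>r>0. \<forall>g\<in>screened_space s p \<tau>.
      screened_seminorm s p \<tau> (\<lambda>x. g x - f x) < ennreal r \<longrightarrow> g \<in> U"
    using r(1) \<open>0 < c\<close> by (intro exI[of _ "r / c"]) auto
qed

theorem theorem3p15:
  fixes \<sigma>1 \<sigma>2 :: "real ^ 'n \<Rightarrow> ereal" and s p :: real
  assumes "screening_function \<sigma>1" and "screening_function \<sigma>2"
    and "0 < (INF x. \<sigma>1 x)" and "(SUP x. \<sigma>1 x) < \<infinity>"
    and "0 < (INF x. \<sigma>2 x)" and "(SUP x. \<sigma>2 x) < \<infinity>"
    and "0 < s" and "s < 1" and "1 \<le> p"
  shows "(\<exists>c0 c1 :: real. 0 < c0 \<and> 0 < c1 \<and>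
           (\<forall>f\<in>L1_loc.
              ennreal c0 * screened_seminorm s p \<sigma>2 f \<le> screened_seminorm s p \<sigma>1 f \<and>
              screened_seminorm s p \<sigma>1 f \<le> ennreal c1 * screened_seminorm s p \<sigma>2 f))
         \<and> screened_space s p \<sigma>1 = screened_space s p \<sigma>2
         \<and> screened_topology s p \<sigma>1 = screened_topology s p \<sigma>2"
proof -
  have "0 \<le> s" "0 \<le> p"
    using assms by auto
  obtain c where c: "0 < c" "\<And>f. f \<in> L1_loc \<Longrightarrow>
      screened_seminorm s p \<sigma>1 f \<le> ennreal c * screened_seminorm s p \<sigma>2 f"
    using screened_seminorm_compare[OF assms(4,5) \<open>0 \<le> s\<close> \<open>0 \<le> p\<close>] by blast
  obtain d where d: "0 < d" "\<And>f. f \<in> L1_loc \<Longrightarrow>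
      screened_seminorm s p \<sigma>2 f \<le> ennreal d * screened_seminorm s p \<sigma>1 f"
    using screened_seminorm_compare[OF assms(6,3) \<open>0 \<le> s\<close> \<open>0 \<le> p\<close>] by blast
  \<comment> \<open>The lower constant is the reciprocal of the constant in the reversed
    estimate.\<close>
  have "ennreal (1 / d) * screened_seminorm s p \<sigma>2 f \<le> screened_seminorm s p \<sigma>1 f"
    if "f \<in> L1_loc" for f
  proof -
    have "ennreal (1 / d) * screened_seminorm s p \<sigma>2 f
        \<le> ennreal (1 / d) * (ennreal d * screened_seminorm s p \<sigma>1 f)"
      using d(2)[OF that] by (intro mult_left_mono) auto
    also have "\<dots> = screened_seminorm s p \<sigma>1 f"
      using d(1) by (simp flip: mult.assoc ennreal_mult')
    finally show ?thesis .
  qed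
  then have norms: "\<exists>c0 c1 :: real. 0 < c0 \<and> 0 < c1 \<and>
           (\<forall>f\<in>L1_loc.
              ennreal c0 * screened_seminorm s p \<sigma>2 f \<le> screened_seminorm s p \<sigma>1 f \<and>
              screened_seminorm s p \<sigma>1 f \<le> ennreal c1 * screened_seminorm s p \<sigma>2 f)"
    using c d(1) by (intro exI[of _ "1 / d"] exI[of _ c]) auto
  have eq: "screened_space s p \<sigma>1 = screened_space s p \<sigma>2"
    using screened_space_mono[OF c(2)] screened_space_mono[OF d(2)] by blast
  have "screened_topology s p \<sigma>1 = screened_topology s p \<sigma>2"
    unfolding topology_eq
    \<comment> \<open>Each of the two estimates transfers open sets in one direction.\<close>
    using openin_screened_topology_mono[OF c(2) c(1) eq]
      openin_screened_topology_mono[OF d(2) d(1) eq[symmetric]] by blast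
  with norms eq show ?thesis by blast
qed

end
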